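(* Let $G$ be a graph of order $n$, and write $I(G;x)=\sum_{k=0}^{\alpha(G)} s_k x^k$ and $I(G^*;x)=\sum_{k=0}^{\alpha(G^* )} t_k x^k$ (note $\alpha(G^* )=n$). Then: (i) $I(G^*;x)=\sum_{k=0}^{\alpha(G)} s_k x^k (1+x)^{n-k} = (1+x)^{\alpha(G^* )-\alpha(G)}\sum_{k=0}^{\alpha(G)} s_k x^k (1+x)^{\alpha(G)-k}$, and the coefficients are related by $$t_k=\sum_{j=0}^{k} s_j\binom{n-j}{n-k},\quad k\in\{0,1,\dots,n\},\qquad s_k=\sum_{j=0}^{k}(-1)^{k+j}\, t_j\binom{n-j}{n-k},\quad k\in\{0,1,\dots,\alpha(G)\},$$ where $s_j=0$ for $j>\alpha(G)$; in particular $t_0=1$ and $t_n=s_0+s_1+\dots+s_{\alpha(G)}$. (ii) $t_0\le t_1\le \dots\le t_j$, where $j=\lceil n/2\rceil$.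
   Context: All graphs are finite, simple, undirected. A stable set is a set of pairwise non-adjacent vertices; $\alpha(G)$ is the maximum size of a stable set of $G$. If $s_k$ denotes the number of stable sets of cardinality $k$ in $G$ (with $s_0=1$, counting the empty set), the independence polynomial is $I(G;x)=\sum_{k=0}^{\alpha(G)} s_k x^k$. For a graph $G$ with vertex set $\{v_1,\dots,v_n\}$, $G^*$ denotes the graph obtained from $G$ by adding $n$ new vertices $u_1,\dots,u_n$ and the edges $u_iv_i$ ($1\le i\le n$), i.e., appending a single pendant edge to each vertex of $G$. *)

theory Defs
  imports "Graph_Theory.Pair_Digraph" "HOL-Computational_Algebra.Polynomial"
begin

text \<open>Finite simple undirected graphs are the library's \<^locale>\<open>pair_graph\<close>s: finite vertex set,
  symmetric and irreflexive arc set, so that an edge \<open>uv\<close> is the pair of arcs \<open>(u, v)\<close>, \<open>(v, u)\<close>.\<close>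

definition stable :: "'a pair_pre_digraph \<Rightarrow> 'a set \<Rightarrow> bool" where
  "stable G U \<longleftrightarrow> U \<subseteq> pverts G \<and> pairwise (\<lambda>u v. (u, v) \<notin> parcs G) U"

definition stability_number :: "'a pair_pre_digraph \<Rightarrow> nat" where
  "stability_number G = Max (card ` {U. stable G U})"

definition num_stable :: "'a pair_pre_digraph \<Rightarrow> nat \<Rightarrow> nat" where
  "num_stable G k = card {U. stable G U \<and> card U = k}"

definition indep_poly :: "'a pair_pre_digraph \<Rightarrow> int poly" where
  "indep_poly G = (\<Sum>k=0..stability_number G. monom (int (num_stable G k)) k)"

text \<open>The graph \<open>G\<^sup>*\<close>: \<open>Inl v\<close> is the vertex \<open>v\<close> of \<open>G\<close> and \<open>Inr v\<close> is the new pendant vertex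
  attached to it.\<close>

definition pendant_graph :: "'a pair_pre_digraph \<Rightarrow> ('a + 'a) pair_pre_digraph" where
  "pendant_graph G =
    \<lparr> pverts = Inl ` pverts G \<union> Inr ` pverts G,
      parcs = {(Inl u, Inl v) | u v. (u, v) \<in> parcs G}
            \<union> {(Inl v, Inr v) | v. v \<in> pverts G}
            \<union> {(Inr v, Inl v) | v. v \<in> pverts G} \<rparr>"

lemma pair_graph_pendant_graph:
  assumes "pair_graph G"
  shows "pair_graph (pendant_graph G)"
proof -
  interpret pair_graph G by fact
  have ends: "u \<in> pverts G \<and> v \<in> pverts G" if "(u, v) \<in> parcs G" for u v
    using arc_fst_in_verts[OF that] arc_snd_in_verts[OF that] by simp
  have fin: "finite (pverts (pendant_graph G))"
    by (simp add: pendant_graph_def)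
  have sub: "parcs (pendant_graph G) \<subseteq> pverts (pendant_graph G) \<times> pverts (pendant_graph G)"
    by (auto simp: pendant_graph_def dest: ends)
  have "finite (parcs (pendant_graph G))"
    using fin sub by (meson finite_SigmaI finite_subset)
  moreover have "sym (parcs (pendant_graph G))"
    using arcs_symmetric by (auto simp: pendant_graph_def sym_def)
  moreover have "u \<noteq> v" if "(u, v) \<in> parcs (pendant_graph G)" for u v
    using that pair_no_loops by (fastforce simp: pendant_graph_def)
  ultimately show ?thesis
    using fin sub by unfold_locales (auto simp: symmetric_def)
qed

end

theory Submission
  imports Defs
begin

text \<open>A stable set of \<open>G\<^sup>*\<close> is a stable set \<open>U\<close> of \<open>G\<close> together with pendant vertices attached
  to an arbitrary set of vertices outside \<open>U\<close>. Counting by cardinality, \<open>t\<^sub>k\<close> is the sum of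
  \<open>s\<^sub>j \<cdot> (n - j choose k - j)\<close> over \<open>j \<le> k\<close>, which is the coefficient form of the polynomial
  identity. Binomial inversion recovers \<open>s\<close>. For \<open>2 i < n\<close> every summand of \<open>t\<^sub>i\<close> is at most the
  summand of \<open>t\<^sub>i\<^sub>+\<^sub>1\<close> with the same index, as \<open>2 (i - j) < n - j\<close>.\<close>

section \<open>Stable sets and coefficients of the independence polynomial\<close>

lemma stable_subset_verts: "stable G U \<Longrightarrow> U \<subseteq> pverts G"
  by (simp add: stable_def)

lemma finite_stable: "finite (pverts G) \<Longrightarrow> finite {U. stable G U}"
  by (rule finite_subset[of _ "Pow (pverts G)"]) (auto dest: stable_subset_verts)

lemma stable_empty: "stable G {}"
  by (simp add: stable_def)

lemma card_stable_le_stability_number: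
  assumes "finite (pverts G)" "stable G U"
  shows "card U \<le> stability_number G"
  unfolding stability_number_def using assms finite_stable by (intro Max_ge) auto

lemma stability_number_le_card_verts:
  assumes "finite (pverts G)"
  shows "stability_number G \<le> card (pverts G)"
  unfolding stability_number_def
  using assms finite_stable[OF assms] stable_empty[of G]
  by (subst Max_le_iff) (auto intro: card_mono dest: stable_subset_verts)

lemma num_stable_eq_0:
  assumes "finite (pverts G)" "stability_number G < k"
  shows "num_stable G k = 0"
proof -
  have "{U. stable G U \<and> card U = k} = {}"
    using card_stable_le_stability_number[OF assms(1)] assms(2) by fastforce
  then show ?thesis by (simp only: num_stable_def card.empty)
qed

lemma num_stable_0:
  assumes "finite (pverts G)"
  shows "num_stable G 0 = 1"
proof -
  \<comment> \<open>Infinite sets also have \<open>card\<close> 0; finiteness of the vertex set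
    excludes them.\<close>
  have "{U. stable G U \<and> card U = 0} = {{}}"
    using assms by (auto simp: stable_empty card_eq_0_iff dest!: stable_subset_verts
        dest: finite_subset)
  then show ?thesis by (simp add: num_stable_def)
qed

text \<open>The sum defining the polynomial stops at the stability number, but all later counts
  vanish, so coefficients can be compared at every index.\<close>

lemma coeff_indep_poly:
  assumes "finite (pverts G)"
  shows "coeff (indep_poly G) k = int (num_stable G k)"
proof -
  have "coeff (indep_poly G) k
      = (\<Sum>j=0..stability_number G. if j = k then int (num_stable G k) else 0)"
    by (auto simp: indep_poly_def coeff_sum intro!: sum.cong)
  also have "\<dots> = int (num_stable G k)"
    using num_stable_eq_0[OF assms, of k] by (simp add: not_le)
  finally show ?thesis .
qed

section \<open>Stable sets of the pendant graph\<close>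

lemma sum_set_cases:
  obtains U W where "X = U <+> W"
proof
  show "X = (Inl -` X) <+> (Inr -` X)"
    by (auto simp: Plus_def image_iff) (metis sumE)
qed

text \<open>Pendant vertices are pairwise non-adjacent, and \<open>Inr w\<close> is adjacent only to
  \<open>Inl w\<close>. Hence disjointness is the only interaction between \<open>U\<close> and
  \<open>W\<close>.\<close>

lemma stable_pendant_graph_Plus_iff:
  "stable (pendant_graph G) (U <+> W) \<longleftrightarrow> stable G U \<and> W \<subseteq> pverts G - U"
proof -
  have ball: "(\<forall>x\<in>U <+> W. P x) \<longleftrightarrow> (\<forall>u\<in>U. P (Inl u)) \<and> (\<forall>w\<in>W. P (Inr w))" for P
    by blast
  have arcs:
    "(Inl u, Inl v) \<in> parcs (pendant_graph G) \<longleftrightarrow> (u, v) \<in> parcs G"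
    "(Inl u, Inr v) \<in> parcs (pendant_graph G) \<longleftrightarrow> u = v \<and> v \<in> pverts G"
    "(Inr u, Inl v) \<in> parcs (pendant_graph G) \<longleftrightarrow> u = v \<and> v \<in> pverts G"
    "(Inr u, Inr v) \<notin> parcs (pendant_graph G)" for u v
    by (auto simp: pendant_graph_def)
  have verts: "U <+> W \<subseteq> pverts (pendant_graph G) \<longleftrightarrow> U \<subseteq> pverts G \<and> W \<subseteq> pverts G"
    unfolding subset_eq ball by (auto simp: pendant_graph_def)
  show ?thesis
    unfolding stable_def verts pairwise_def ball by (auto simp: arcs)
qed

text \<open>In a stable \<open>U <+> W\<close> the parts are disjoint sets of vertices of
  \<open>G\<close>, which gives the upper bound; the set of all pendant vertices attains it.\<close>

lemma stability_number_pendant_graph: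
  assumes "finite (pverts G)"
  shows "stability_number (pendant_graph G) = card (pverts G)"
proof (rule antisym)
  have fin: "finite (pverts (pendant_graph G))"
    using assms by (simp add: pendant_graph_def)
  have bound: "card X \<le> card (pverts G)" if "stable (pendant_graph G) X" for X
  proof -
    obtain U W where X: "X = U <+> W"
      by (rule sum_set_cases)
    then have UW: "U \<subseteq> pverts G" "W \<subseteq> pverts G - U"
      using that by (auto simp: stable_pendant_graph_Plus_iff dest: stable_subset_verts)
    then have "card X = card (U \<union> W)"
      using assms by (subst card_Un_disjoint) (auto simp: X card_Plus finite_subset)
    then show ?thesis using UW assms by (auto intro: card_mono)
  qed
  show "stability_number (pendant_graph G) \<le> card (pverts G)"
    unfolding stability_number_def
    using finite_stable[OF fin] stable_empty[of "pendant_graph G"] bound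
    by (subst Max_le_iff) auto
  have "stable (pendant_graph G) ({} <+> pverts G)"
    by (simp add: stable_pendant_graph_Plus_iff stable_empty)
  from card_stable_le_stability_number[OF fin this]
  show "card (pverts G) \<le> stability_number (pendant_graph G)"
    using assms by (simp add: card_Plus)
qed

text \<open>With \<open>k - j\<close> below, the formula holds for all \<open>k\<close>; with
  \<open>n - k\<close> below, truncated subtraction would break it for \<open>k > n\<close>.\<close>

theorem num_stable_pendant_graph:
  assumes "finite (pverts G)"
  shows "num_stable (pendant_graph G) k
    = (\<Sum>j=0..k. num_stable G j * ((card (pverts G) - j) choose (k - j)))"
proof -
  let ?V = "pverts G"
  \<comment> \<open>The bound on \<open>card U\<close> makes \<open>k - card U\<close> in
    \<open>B\<close> a true difference.\<close>
  define A where "A = {U. stable G U \<and> card U \<le> k}"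
  define B where "B = (\<lambda>U. {W. W \<subseteq> ?V - U \<and> card W = k - card U})"
  have fin: "finite U" if "U \<subseteq> ?V" for U
    using that assms by (rule finite_subset)
  have finA: "finite A"
    using finite_stable[OF assms] by (rule rev_finite_subset) (auto simp: A_def)
  have finB: "finite (B U)" for U
    using assms by (auto simp: B_def)
  have "{X. stable (pendant_graph G) X \<and> card X = k} = (\<lambda>(U, W). U <+> W) ` Sigma A B"
  proof (intro set_eqI iffI)
    fix X assume X: "X \<in> {X. stable (pendant_graph G) X \<and> card X = k}"
    obtain U W where UW: "X = U <+> W" by (rule sum_set_cases)
    have st: "stable G U" "W \<subseteq> ?V - U"
      using X by (auto simp: UW stable_pendant_graph_Plus_iff)
    then have "finite U" "finite W"
      by (auto intro: fin dest: stable_subset_verts)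
    then have "card U + card W = k"
      using X by (simp add: UW card_Plus)
    then have "(U, W) \<in> Sigma A B"
      using st by (auto simp: A_def B_def)
    then show "X \<in> (\<lambda>(U, W). U <+> W) ` Sigma A B"
      using UW by (intro image_eqI[of _ _ "(U, W)"]) simp_all
  next
    fix X assume "X \<in> (\<lambda>(U, W). U <+> W) ` Sigma A B"
    then obtain U W where UW: "X = U <+> W" "stable G U" "W \<subseteq> ?V - U"
      "card U \<le> k" "card W = k - card U"
      by (auto simp: A_def B_def)
    then have "finite U" "finite W"
      by (auto intro: fin dest: stable_subset_verts)
    then show "X \<in> {X. stable (pendant_graph G) X \<and> card X = k}"
      using UW by (simp add: stable_pendant_graph_Plus_iff card_Plus)
  qed
  moreover have "inj_on (\<lambda>(U, W). U <+> W) (Sigma A B)"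
    by (rule inj_onI) (auto simp: Plus_def set_eq_iff image_iff)
  ultimately have "num_stable (pendant_graph G) k = card (Sigma A B)"
    by (simp add: num_stable_def card_image)
  also have "\<dots> = (\<Sum>U\<in>A. card (B U))"
    using finA finB by simp
  also have "\<dots> = (\<Sum>U\<in>A. (card ?V - card U) choose (k - card U))"
  proof (rule sum.cong[OF refl])
    fix U assume "U \<in> A"
    then have "U \<subseteq> ?V" by (auto simp: A_def dest: stable_subset_verts)
    then have "card (?V - U) = card ?V - card U"
      using fin by (intro card_Diff_subset) auto
    then show "card (B U) = (card ?V - card U) choose (k - card U)"
      using n_subsets[of "?V - U"] assms by (simp add: B_def)
  qed
  also have "\<dots> = (\<Sum>j=0..k. \<Sum>U\<in>{U \<in> A. card U = j}. (card ?V - card U) choose (k - card U))"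
    using finA by (intro sum.group[symmetric]) (auto simp: A_def)
  also have "\<dots> = (\<Sum>j=0..k. num_stable G j * ((card ?V - j) choose (k - j)))"
  proof (rule sum.cong[OF refl])
    fix j assume "j \<in> {0..k}"
    then have "{U \<in> A. card U = j} = {U. stable G U \<and> card U = j}"
      by (auto simp: A_def)
    then show "(\<Sum>U\<in>{U \<in> A. card U = j}. (card ?V - card U) choose (k - card U))
        = num_stable G j * ((card ?V - j) choose (k - j))"
      by (simp add: num_stable_def)
  qed
  finally show ?thesis .
qed

section \<open>The polynomial identity\<close>

lemma coeff_monom_mult_one_plus_X_power:
  "coeff ([:0, 1:] ^ j * [:1, 1:] ^ m :: 'a::comm_semiring_1 poly) k
    = (if k < j then 0 else of_nat (m choose (k - j)))"
proof -
  have "coeff ([:1, 1:] ^ m :: 'a poly) i = of_nat (m choose i)" for i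
  proof (cases "i \<le> m")
    case True
    then show ?thesis by (simp add: coeff_linear_poly_power)
  next
    case False
    then show ?thesis by (simp add: coeff_eq_0 degree_linear_power binomial_eq_0)
  qed
  moreover have "[:0, 1:] ^ j = (monom 1 j :: 'a poly)"
    by (simp add: monom_altdef)
  ultimately show ?thesis by (simp add: coeff_monom_mult)
qed

theorem indep_poly_pendant_graph:
  assumes "finite (pverts G)"
  shows "indep_poly (pendant_graph G) = (\<Sum>k=0..stability_number G.
    of_nat (num_stable G k) * [:0, 1:] ^ k * [:1, 1:] ^ (card (pverts G) - k))"
proof (rule poly_eqI)
  fix k
  let ?s = "num_stable G" and ?n = "card (pverts G)" and ?a = "stability_number G"
  let ?f = "\<lambda>j. if k < j then 0 else int (?s j) * int ((?n - j) choose (k - j))"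
  have "finite (pverts (pendant_graph G))"
    using assms by (simp add: pendant_graph_def)
  then have "coeff (indep_poly (pendant_graph G)) k = (\<Sum>j=0..k. ?f j)"
    by (simp add: coeff_indep_poly num_stable_pendant_graph[OF assms])
  \<comment> \<open>Neither range need contain the other: terms with \<open>j > ?a\<close> vanish
    because \<open>?s j = 0\<close>, those with \<open>j > k\<close> by the case split in
    \<open>?f\<close>.\<close>
  also have "\<dots> = (\<Sum>j=0..?a. ?f j)"
    by (rule sum.mono_neutral_cong) (auto simp: num_stable_eq_0[OF assms])
  also have "\<dots> = (\<Sum>j=0..?a. coeff (of_nat (?s j) * ([:0, 1:] ^ j * [:1, 1:] ^ (?n - j))) k)"
  proof (rule sum.cong[OF refl])
    fix j
    have "of_nat (?s j) * p = smult (int (?s j)) p" for p :: "int poly"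
      by (simp add: of_nat_poly)
    then show "?f j = coeff (of_nat (?s j) * ([:0, 1:] ^ j * [:1, 1:] ^ (?n - j))) k"
      by (simp add: coeff_monom_mult_one_plus_X_power)
  qed
  finally show "coeff (indep_poly (pendant_graph G)) k
      = coeff (\<Sum>j=0..?a. of_nat (?s j) * [:0, 1:] ^ j * [:1, 1:] ^ (?n - j)) k"
    by (simp add: coeff_sum mult.assoc)
qed

section \<open>Binomial inversion\<close>

lemma binomial_inversion:
  fixes s t :: "nat \<Rightarrow> 'a::comm_ring_1"
  assumes t: "\<And>k. k \<le> n \<Longrightarrow> t k = (\<Sum>j=0..k. s j * of_nat ((n - j) choose (n - k)))"
    and "k \<le> n"
  shows "s k = (\<Sum>j=0..k. (-1) ^ (k + j) * t j * of_nat ((n - j) choose (n - k)))"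
proof -
  let ?c = "\<lambda>i j. of_nat ((n - i) choose (n - j)) :: 'a"
  \<comment> \<open>Up to signs, the two triangular matrices of binomials are inverse to each
    other.\<close>
  have inner: "(\<Sum>j=0..k. (-1) ^ (k + j) * ?c i j * ?c j k) = (if i = k then 1 else 0)"
    if "i \<le> k" for i
  proof -
    have "(\<Sum>j=0..k. (-1) ^ (k + j) * ?c i j * ?c j k)
        = (\<Sum>j=i..k. (-1) ^ (k + j) * ?c i j * ?c j k)"
      using that \<open>k \<le> n\<close> by (intro sum.mono_neutral_right) (auto simp: binomial_eq_0)
    also have "\<dots> = (\<Sum>j=i..k. ?c i k * ((-1) ^ (k - j) * of_nat ((k - i) choose (k - j))))"
    proof (rule sum.cong[OF refl])
      fix j assume j: "j \<in> {i..k}"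
      \<comment> \<open>Trinomial revision: only the second factor on the right depends on
        \<open>j\<close>, so the rest leaves the sum.\<close>
      have "((n - i) choose (n - j)) * ((n - j) choose (n - k))
          = ((n - i) choose (n - k)) * ((k - i) choose (k - j))"
        using choose_mult[of "n - k" "n - j" "n - i"] j \<open>k \<le> n\<close> by auto
      then have "?c i j * ?c j k = ?c i k * of_nat ((k - i) choose (k - j))"
        by (metis of_nat_mult)
      moreover have "(-1) ^ (k + j) = ((-1) ^ (k - j) :: 'a)"
        using j by (auto simp: minus_one_power_iff)
      ultimately show "(-1) ^ (k + j) * ?c i j * ?c j k
          = ?c i k * ((-1) ^ (k - j) * of_nat ((k - i) choose (k - j)))"
        by (simp add: algebra_simps)
    qed
    also have "\<dots> = ?c i k * (\<Sum>j=i..k. (-1) ^ (k - j) * of_nat ((k - i) choose (k - j)))"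
      by (simp add: sum_distrib_left)
    also have "(\<Sum>j=i..k. (-1) ^ (k - j) * of_nat ((k - i) choose (k - j)))
        = (\<Sum>m\<le>k - i. (-1) ^ m * of_nat ((k - i) choose m) :: 'a)"
      using that
      by (intro sum.reindex_bij_witness[of _ "\<lambda>m. k - m" "\<lambda>j. k - j"]) auto
    \<comment> \<open>The alternating sum of a row of Pascal's triangle is 0, except for row 0,
      which is the case \<open>i = k\<close>.\<close>
    finally show ?thesis
      using that choose_alternating_sum[of "k - i", where ?'a = 'a] by auto
  qed
  have "(\<Sum>j=0..k. (-1) ^ (k + j) * t j * ?c j k)
      = (\<Sum>j=0..k. \<Sum>i=0..k. s i * ((-1) ^ (k + j) * ?c i j * ?c j k))"
  proof (rule sum.cong[OF refl])
    fix j assume j: "j \<in> {0..k}"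
    then have "t j = (\<Sum>i=0..j. s i * ?c i j)"
      using \<open>k \<le> n\<close> by (intro t) simp
    \<comment> \<open>Padding with zero terms makes the index range a square, so that the sums can
      be swapped.\<close>
    also have "\<dots> = (\<Sum>i=0..k. s i * ?c i j)"
      using j \<open>k \<le> n\<close> by (intro sum.mono_neutral_left) (auto simp: binomial_eq_0)
    finally show "(-1) ^ (k + j) * t j * ?c j k
        = (\<Sum>i=0..k. s i * ((-1) ^ (k + j) * ?c i j * ?c j k))"
      by (simp add: sum_distrib_left sum_distrib_right algebra_simps)
  qed
  also have "\<dots> = (\<Sum>i=0..k. s i * (\<Sum>j=0..k. (-1) ^ (k + j) * ?c i j * ?c j k))"
    by (subst sum.swap) (simp add: sum_distrib_left)
  also have "\<dots> = (\<Sum>i=0..k. if i = k then s k else 0)"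
    by (intro sum.cong) (simp_all add: inner)
  finally show ?thesis by simp
qed

section \<open>Monotonicity and assembly of the theorem\<close>

lemma binomial_le_binomial_Suc:
  assumes "2 * k < n"
  shows "n choose k \<le> n choose Suc k"
proof (cases "n = 2 * k + 1")
  \<comment> \<open>Here \<open>k\<close> and \<open>Suc k\<close> are the two middle indices, with
    equal binomials. Otherwise \<open>2 * Suc k \<le> n\<close>, and binomials increase up to the
    middle.\<close>
  case True
  then show ?thesis using binomial_symmetric[of k n] by simp
next
  case False
  then show ?thesis using assms by (intro binomial_mono) auto
qed

theorem theorem3:
  fixes G :: "'a pair_pre_digraph"
    and n :: nat
    and s t :: "nat \<Rightarrow> nat"
  assumes "pair_graph G"
    and "card (pverts G) = n"
    and "\<And>k. s k = num_stable G k"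
    and "\<And>k. t k = num_stable (pendant_graph G) k"
  shows "stability_number (pendant_graph G) = n
    \<and> indep_poly (pendant_graph G)
        = (\<Sum>k=0..stability_number G. of_nat (s k) * [:0, 1:] ^ k * [:1, 1:] ^ (n - k))
    \<and> indep_poly (pendant_graph G)
        = [:1, 1:] ^ (stability_number (pendant_graph G) - stability_number G)
          * (\<Sum>k=0..stability_number G.
               of_nat (s k) * [:0, 1:] ^ k * [:1, 1:] ^ (stability_number G - k))
    \<and> (\<forall>j>stability_number G. s j = 0)
    \<and> (\<forall>k\<in>{0..n}. t k = (\<Sum>j=0..k. s j * ((n - j) choose (n - k))))
    \<and> (\<forall>k\<in>{0..stability_number G}.
         int (s k) = (\<Sum>j=0..k. (-1) ^ (k + j) * int (t j) * int ((n - j) choose (n - k))))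
    \<and> t 0 = 1
    \<and> t n = (\<Sum>k=0..stability_number G. s k)
    \<and> (\<forall>i<nat \<lceil>real n / 2\<rceil>. t i \<le> t (Suc i))"
proof -
  interpret pair_graph G by fact
  let ?H = "pendant_graph G" and ?a = "stability_number G"
  have fin: "finite (pverts G)" by simp
  note n = \<open>card (pverts G) = n\<close> and s = assms(3) and t = assms(4)
  have finH: "finite (pverts ?H)" by (simp add: pendant_graph_def)
  have alpha_H: "stability_number ?H = n"
    using stability_number_pendant_graph[OF fin] n by simp
  have alpha_le: "?a \<le> n"
    using stability_number_le_card_verts[OF fin] n by simp
  have s_zero: "s j = 0" if "?a < j" for j
    using num_stable_eq_0[OF fin that] s by simp
  have poly: "indep_poly ?H = (\<Sum>k=0..?a. of_nat (s k) * [:0, 1:] ^ k * [:1, 1:] ^ (n - k))"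
    using indep_poly_pendant_graph[OF fin] n s by simp
  have poly_factored: "indep_poly ?H = [:1, 1:] ^ (stability_number ?H - ?a)
      * (\<Sum>k=0..?a. of_nat (s k) * [:0, 1:] ^ k * [:1, 1:] ^ (?a - k))"
    unfolding poly alpha_H sum_distrib_left
  proof (rule sum.cong[OF refl])
    fix k assume "k \<in> {0..?a}"
    \<comment> \<open>No subtraction truncates, since \<open>k \<le> ?a \<le> n\<close>.\<close>
    then have "n - k = (n - ?a) + (?a - k)"
      using alpha_le by simp
    then show "of_nat (s k) * [:0, 1:] ^ k * [:1, 1:] ^ (n - k) =
        [:1, 1:] ^ (n - ?a) * (of_nat (s k) * [:0, 1:] ^ k * [:1, 1:] ^ (?a - k) :: int poly)"
      by (simp only: power_add mult.left_commute)
  qed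
  have t_eq: "t k = (\<Sum>j=0..k. s j * ((n - j) choose (k - j)))" for k
    using num_stable_pendant_graph[OF fin] n s t by simp
  have t_eq': "t k = (\<Sum>j=0..k. s j * ((n - j) choose (n - k)))" if "k \<le> n" for k
    unfolding t_eq
  proof (rule sum.cong[OF refl])
    fix j assume "j \<in> {0..k}"
    then show "s j * ((n - j) choose (k - j)) = s j * ((n - j) choose (n - k))"
      using that binomial_symmetric[of "k - j" "n - j"] by simp
  qed
  have s_eq: "int (s k) = (\<Sum>j=0..k. (-1) ^ (k + j) * int (t j) * int ((n - j) choose (n - k)))"
    if "k \<le> n" for k
    by (rule binomial_inversion[OF _ that]) (simp add: t_eq')
  have t_n: "t n = (\<Sum>k=0..?a. s k)"
  proof -
    \<comment> \<open>At \<open>k = n\<close> the lower index \<open>n - k\<close> is 0, so every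
      binomial is 1.\<close>
    have "t n = (\<Sum>k=0..n. s k)"
      by (simp add: t_eq')
    also have "\<dots> = (\<Sum>k=0..?a. s k)"
      using alpha_le s_zero by (intro sum.mono_neutral_right) auto
    finally show ?thesis .
  qed
  have mono: "t i \<le> t (Suc i)" if "i < nat \<lceil>real n / 2\<rceil>" for i
  proof -
    \<comment> \<open>Since \<open>i\<close> is an integer, \<open>i < \<lceil>n / 2\<rceil>\<close>
      means \<open>i < n / 2\<close>.\<close>
    have i: "2 * i < n" using that by linarith
    have "t i \<le> (\<Sum>j=0..i. s j * ((n - j) choose (Suc i - j)))"
      unfolding t_eq
    proof (intro sum_mono mult_left_mono)
      fix j assume j: "j \<in> {0..i}"
      then have "(n - j) choose (i - j) \<le> (n - j) choose Suc (i - j)"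
        using i by (intro binomial_le_binomial_Suc) auto
      then show "(n - j) choose (i - j) \<le> (n - j) choose (Suc i - j)"
        using j by (simp add: Suc_diff_le)
    qed simp
    \<comment> \<open>The sum for \<open>t (Suc i)\<close> has one more nonnegative summand, at
      \<open>j = Suc i\<close>.\<close>
    also have "\<dots> \<le> t (Suc i)"
      unfolding t_eq by (intro sum_mono2) auto
    finally show ?thesis .
  qed
  show ?thesis
    using alpha_le num_stable_0[OF finH] t
    by (intro conjI ballI allI impI alpha_H poly poly_factored s_zero t_eq' s_eq t_n mono) auto
qed

end
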